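(* Let $w\in\mathbb C^d$, $w\ne0$, let $s_1,\dots,s_R\in\{1,\dots,d\}$ be distinct shift positions and $y^1,\dots,y^R\in[0,\infty)^d$ be ptychographic measurements. Let $\{z^t\}_{t\ge0}$ be generated by the Ptychographic Iterative Engine, $$z^{t+1}=z^t+\frac{\alpha_t}{\|w\|_\infty^2}\operatorname{diag}(\overline{S_{s_{r^t}}w})\left[F^{-1}\left(\sqrt{y^{r^t}}\circ\operatorname{sgn}\left(F[S_{s_{r^t}}w\circ z^t]\right)\right)-S_{s_{r^t}}w\circ z^t\right],$$ with an arbitrary starting point $z^0\in\mathbb C^d$, where the indices $r^t$ are drawn independently with uniform probabilities $p_r=1/R$, $r\in\{1,\dots,R\}$. Let $\alpha_t=\alpha/(1+t)^{1/2+\theta}$ for some $\alpha>0$ and $0<\theta<1/2$. Then the sequence $\{\mathcal L(z^t)\}_{t\ge0}$ converges almost surely, and $$\min_{t=0,\dots,T-1}\|\nabla_z\mathcal L(z^t)\|_2^2=o\left(T^{-(1/2-\theta)}\right)\quad\text{as }T\to\infty,\ \text{almost surely.}$$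
   Context: $F\in\mathbb C^{d\times d}$ is the discrete Fourier transform matrix, $F_{k,j}=e^{-2\pi i(k-1)(j-1)/d}$. $S_s$ is the circular shift $(S_sv)_j=v_{((j-1-s)\bmod d)+1}$, $j\in\{1,\dots,d\}$. $\operatorname{diag}(v)$ is the diagonal matrix with diagonal $v$; $\overline v$ is the complex conjugate; $\circ$ is the entrywise product; $|\cdot|$, $\sqrt\cdot$ and $\operatorname{sgn}$ act entrywise, with $\operatorname{sgn}(a)=a/|a|$ for $a\ne0$ and $\operatorname{sgn}(0)=0$. Ptychographic measurements are $y^r=|F[S_{s_r}w\circ x]|^2+n^r$ for an unknown $x\in\mathbb C^d$ and perturbations $n^r$, $1\le r\le R\le d$. Let $A_r=F\operatorname{diag}(S_{s_r}w)$, let $A$ be the vertical stack of $A_1,\dots,A_R$ and $y=((y^1)^T,\dots,(y^R)^T)^T$. The loss is $\mathcal L(z)=\||Az|-\sqrt y\|_2^2$ and its generalized Wirtinger gradient is $\nabla_z\mathcal L(z)=A^*(Az-\sqrt y\circ\operatorname{sgn}(Az))$. For sequences, $a_T=o(b_T)$ as $T\to\infty$ means $a_T/b_T\to0$. *)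

theory Defs
  imports
    "HOL-Probability.Probability"
    "HOL-Library.Landau_Symbols"
    "Berlekamp_Zassenhaus.Finite_Field"
begin

text \<open>
  Vectors of dimension \<open>d = CARD('d)\<close> are indexed by \<open>'d mod_ring\<close>, that is by the residues
  \<open>0, \<dots>, d - 1\<close>; the residue \<open>j\<close> stands for the one-based position \<open>j + 1\<close>.  The class
  \<open>finite\<close> includes \<open>d = 1\<close>.  The entrywise product of vectors is the library's
  multiplication \<open>v * w\<close> on \<open>'a ^ 'n\<close>; the library's \<open>sgn\<close> on \<open>'a ^ 'n\<close> normalises the whole vector and is
  not the entrywise sign.
\<close>

definition dft :: "complex ^ ('d::finite mod_ring) ^ ('d mod_ring)" where
  "dft = (\<chi> k j. exp (- (2 * of_real pi * \<i> *
      of_int (to_int_mod_ring k) * of_int (to_int_mod_ring j) / of_nat CARD('d))))"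

text \<open>\<open>of_int_mod_ring\<close> reduces its argument modulo \<open>CARD('d)\<close>.\<close>

definition circ_shift :: "nat \<Rightarrow> 'a ^ ('d::finite mod_ring) \<Rightarrow> 'a ^ ('d mod_ring)" where
  "circ_shift s v = (\<chi> j. v $ of_int_mod_ring (to_int_mod_ring j - int s))"

definition diag :: "'a::zero ^ 'n \<Rightarrow> 'a ^ 'n ^ 'n" where
  "diag v = (\<chi> i j. if i = j then v $ i else 0)"

definition conj_vec :: "complex ^ 'n \<Rightarrow> complex ^ 'n" where
  "conj_vec v = (\<chi> i. cnj (v $ i))"

definition conj_transpose :: "complex ^ 'n ^ 'm \<Rightarrow> complex ^ 'm ^ 'n" where
  "conj_transpose M = (\<chi> i j. cnj (M $ j $ i))"

definition abs_vec :: "complex ^ 'n \<Rightarrow> real ^ 'n" where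
  "abs_vec v = (\<chi> i. cmod (v $ i))"

definition sqrt_vec :: "real ^ 'n \<Rightarrow> real ^ 'n" where
  "sqrt_vec v = (\<chi> i. sqrt (v $ i))"

definition sgn_vec :: "complex ^ 'n \<Rightarrow> complex ^ 'n" where
  "sgn_vec v = (\<chi> i. sgn (v $ i))"

definition complex_vec :: "real ^ 'n \<Rightarrow> complex ^ 'n" where
  "complex_vec v = (\<chi> i. complex_of_real (v $ i))"

text \<open>The library's \<open>infnorm\<close> is the maximum over real and imaginary parts, hence not used here.\<close>

definition max_norm :: "complex ^ 'n \<Rightarrow> real" where
  "max_norm v = Max (range (\<lambda>i. cmod (v $ i)))"

definition block_matrix ::
  "complex ^ ('d::finite mod_ring) \<Rightarrow> nat \<Rightarrow> complex ^ ('d mod_ring) ^ ('d mod_ring)" where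
  "block_matrix w s = dft ** diag (circ_shift s w)"

text \<open>In a vertical stack, the row \<open>(r, k)\<close> is row \<open>k\<close> of block \<open>r\<close>.\<close>

definition stack_matrix ::
  "complex ^ ('d::finite mod_ring) \<Rightarrow> ('r::finite \<Rightarrow> nat) \<Rightarrow>
   complex ^ ('d mod_ring) ^ ('r \<times> 'd mod_ring)" where
  "stack_matrix w s = (\<chi> p. block_matrix w (s (fst p)) $ snd p)"

definition stack_vec :: "('r::finite \<Rightarrow> 'a ^ 'n) \<Rightarrow> 'a ^ ('r \<times> 'n)" where
  "stack_vec y = (\<chi> p. y (fst p) $ snd p)"

definition loss ::
  "complex ^ ('d::finite mod_ring) \<Rightarrow> ('r::finite \<Rightarrow> nat) \<Rightarrow> ('r \<Rightarrow> real ^ ('d mod_ring)) \<Rightarrow>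
   complex ^ ('d mod_ring) \<Rightarrow> real" where
  "loss w s y z = (norm (abs_vec (stack_matrix w s *v z) - sqrt_vec (stack_vec y)))\<^sup>2"

definition wirtinger_grad ::
  "complex ^ ('d::finite mod_ring) \<Rightarrow> ('r::finite \<Rightarrow> nat) \<Rightarrow> ('r \<Rightarrow> real ^ ('d mod_ring)) \<Rightarrow>
   complex ^ ('d mod_ring) \<Rightarrow> complex ^ ('d mod_ring)" where
  "wirtinger_grad w s y z = conj_transpose (stack_matrix w s) *v
     (stack_matrix w s *v z
      - complex_vec (sqrt_vec (stack_vec y)) * sgn_vec (stack_matrix w s *v z))"

text \<open>One update of the Ptychographic Iterative Engine: \<open>s\<close> and \<open>y\<close> are the shift and the
  measurement vector of the block that was drawn.\<close>

definition pie_step ::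
  "complex ^ ('d::finite mod_ring) \<Rightarrow> real \<Rightarrow> nat \<Rightarrow> real ^ ('d mod_ring) \<Rightarrow>
   complex ^ ('d mod_ring) \<Rightarrow> complex ^ ('d mod_ring)" where
  "pie_step w a s y z = z + (a / (max_norm w)\<^sup>2) *\<^sub>R
     (diag (conj_vec (circ_shift s w)) *v
       (matrix_inv dft *v (complex_vec (sqrt_vec y) * sgn_vec (dft *v (circ_shift s w * z)))
        - circ_shift s w * z))"

end

theory Submission
  imports Defs
begin

text \<open>
  The engine is stochastic gradient descent on the amplitude loss. Because the Fourier matrix is
  unitary up to scaling, one update equals \<open>z - \<gamma> G\<close>, where \<open>G\<close> is the Wirtinger gradient of the
  loss of the block that was drawn and \<open>\<gamma>\<close> is a constant multiple of the step size
  (\<open>pie_step_eq_gradient_step\<close>).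

  Although the loss is not smooth, it is a quadratic function minus a nonnegative
  combination of norms, and convexity of the norms yields the descent inequality
  \<open>L (z + h) \<le> L z + 2 * (grad L z \<bullet> h) + (norm (A *v h))\<^sup>2\<close> at every point (\<open>amp_loss_descent\<close>). Applied to
  a block step and combined with the bound of the squared block gradient by a multiple of
  the loss, it gives \<open>block_step_descent\<close>. The block gradients add up to the full one, so
  averaging over the uniform draw yields
  \<open>E L (z (t + 1)) \<le> (1 + C \<gamma>\<^sup>2) L (z t) - c \<gamma> (norm (grad L (z t)))\<^sup>2\<close> conditionally on the past.

  As the squared step sizes are summable, the Robbins-Siegmund theorem shows that almost surely the
  loss converges and the series of \<open>\<gamma> (norm (grad L))\<^sup>2\<close> is summable. It is derived here from
  Doob's convergence theorem for nonnegative supermartingales, proved by counting upcrossings. The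
  rate of the running minimum is a statement about single sequences: comparing the
  tail of this series with the sum of the step sizes over the second half of the first \<open>T\<close> steps,
  which grows like \<open>T powr (1/2 - \<theta>)\<close>, gives the claim (\<open>Min_smallo_if_weighted_summable\<close>).
\<close>

section \<open>Convergence of nonnegative supermartingales\<close>

text \<open>
  A trader holds one unit of an asset with price \<open>u\<close>, bought at a price \<open>\<le> a\<close> and sold at the
  next price \<open>\<ge> b\<close>. Whether it is held from time \<open>t\<close> to \<open>t + 1\<close> depends on the prices up to
  time \<open>t\<close> only, which makes the strategy predictable. Its sales are the completed upcrossings of the
  interval from \<open>a\<close> to \<open>b\<close>.
\<close>

primrec holding :: "real \<Rightarrow> real \<Rightarrow> (nat \<Rightarrow> real) \<Rightarrow> nat \<Rightarrow> bool" where
  "holding a b u 0 \<longleftrightarrow> u 0 \<le> a"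
| "holding a b u (Suc t) \<longleftrightarrow> (if holding a b u t then u (Suc t) < b else u (Suc t) \<le> a)"

definition selling :: "real \<Rightarrow> real \<Rightarrow> (nat \<Rightarrow> real) \<Rightarrow> nat \<Rightarrow> bool" where
  "selling a b u t \<longleftrightarrow> holding a b u t \<and> b \<le> u (Suc t)"

text \<open>
  Starting with capital \<open>a\<close>, each sale leaves a profit of at least \<open>b - a\<close>; while the asset is
  held, the reserve \<open>a\<close> has been exchanged for its current price. For a nonnegative price the
  gains plus \<open>a\<close> are therefore at least \<open>b - a\<close> times the number of upcrossings.
\<close>

lemma upcrossing_wealth:
  "(b - a) * (\<Sum>i<t. of_bool (selling a b u i)) + (if holding a b u t then u t else a)
    \<le> a + (\<Sum>i<t. of_bool (holding a b u i) * (u (Suc i) - u i))"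
proof (induction t)
  case 0
  then show ?case by simp
next
  case (Suc t)
  then show ?case
    by (auto simp: selling_def algebra_simps split: if_splits)
qed

lemma infinitely_many_sales:
  assumes "a < b" "\<exists>\<^sub>F t in sequentially. u t \<le> a" "\<exists>\<^sub>F t in sequentially. b \<le> u t"
  shows "\<exists>\<^sub>F t in sequentially. selling a b u t"
proof (rule ccontr)
  assume "\<not> ?thesis"
  then obtain N where N: "\<And>t. N \<le> t \<Longrightarrow> \<not> selling a b u t"
    by (auto simp: not_frequently eventually_sequentially)
  have low: "\<exists>t\<ge>n. u t \<le> a" and high: "\<exists>t\<ge>n. b \<le> u t" for n
    using assms(2,3) by (auto simp: frequently_sequentially)
  from low[of "Suc N"] obtain t where t: "Suc N \<le> t" "u t \<le> a" by blast
  then obtain t' where t': "t = Suc t'" by (cases t) auto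
  have hold: "holding a b u t"
    using t t' \<open>a < b\<close> by auto
  have stay: "holding a b u t''" if "t \<le> t''" for t''
    using that
  proof (induction rule: dec_induct)
    case (step m)
    then show ?case using N[of m] t by (auto simp: selling_def)
  qed (rule hold)
  from high[of "Suc t"] obtain k where k: "Suc t \<le> k" "b \<le> u k" by blast
  then obtain k' where k': "k = Suc k'" by (cases k) auto
  have "selling a b u k'"
    using stay[of k'] k k' by (auto simp: selling_def)
  then show False using N[of k'] k k' t by auto
qed

text \<open>
  If the lower limit lay strictly below the upper one, two rationals would fit strictly between
  them and the sequence would cross the interval they bound infinitely often. Finiteness of the lower limit
  excludes divergence to infinity. Rational endpoints leave countably many conditions, each of
  which may then fail on a null set.
\<close>

lemma convergent_if_finitely_many_upcrossings:
  fixes u :: "nat \<Rightarrow> real"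
  assumes nonneg: "\<And>t. 0 \<le> u t"
    and fin: "liminf (\<lambda>t. ennreal (u t)) < \<infinity>"
    and cross: "\<And>a b. a \<in> \<rat> \<Longrightarrow> b \<in> \<rat> \<Longrightarrow> 0 \<le> a \<Longrightarrow> a < b \<Longrightarrow> \<not> (\<exists>\<^sub>F t in sequentially. selling a b u t)"
  shows "convergent u"
proof -
  let ?l = "liminf (\<lambda>t. ennreal (u t))" and ?L = "limsup (\<lambda>t. ennreal (u t))"
  have "?L \<le> ?l"
  proof (rule ccontr)
    assume "\<not> ?L \<le> ?l"
    then have "?l < ?L" by simp
    obtain l where l: "?l = ennreal l" "0 \<le> l" using fin by (cases ?l) auto
    obtain c where c: "?l < c" "c < ?L" using dense[OF \<open>?l < ?L\<close>] by blast
    obtain c' where c': "c = ennreal c'" "0 \<le> c'" using c by (cases c) auto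
    have "l < c'" using c(1) l c' by (simp add: ennreal_less_iff)
    then obtain a where a: "a \<in> \<rat>" "l < a" "a < c'" using Rats_dense_in_real by blast
    then obtain b where b: "b \<in> \<rat>" "a < b" "b < c'" using Rats_dense_in_real by blast
    have a0: "0 \<le> a" using a l by simp
    have "\<exists>\<^sub>F t in sequentially. u t \<le> a"
    proof (rule ccontr)
      assume "\<not> ?thesis"
      then have "\<forall>\<^sub>F t in sequentially. ennreal a \<le> ennreal (u t)"
        by (auto simp: not_frequently elim!: eventually_mono intro!: ennreal_leI)
      then have "ennreal a \<le> ?l" by (rule Liminf_bounded)
      then show False using l a by simp
    qed
    moreover have "\<exists>\<^sub>F t in sequentially. b \<le> u t"
    proof (rule ccontr)
      assume "\<not> ?thesis"
      then have "\<forall>\<^sub>F t in sequentially. ennreal (u t) \<le> ennreal b"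
        by (auto simp: not_frequently elim!: eventually_mono intro!: ennreal_leI)
      then have "?L \<le> ennreal b" by (rule Limsup_bounded)
      also have "\<dots> < c" using b a0 c' by (simp add: ennreal_less_iff)
      finally show False using c by simp
    qed
    ultimately show False
      using infinitely_many_sales[OF b(2)] cross[OF a(1) b(1) a0 b(2)] by blast
  qed
  then have "?l = ?L"
    by (intro antisym Liminf_le_Limsup) auto
  moreover obtain l where l: "?l = ennreal l" "0 \<le> l" using fin by (cases ?l) auto
  ultimately have "(\<lambda>t. ennreal (u t)) \<longlonglongrightarrow> ennreal l"
    by (intro Liminf_eq_Limsup) auto
  then have "u \<longlonglongrightarrow> l"
    using nonneg l by (subst (asm) tendsto_ennreal_iff) auto
  then show ?thesis by (auto simp: convergent_def)
qed

locale discrete_filtration =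
  fixes M :: "'a measure" and F :: "nat \<Rightarrow> 'a measure"
  assumes sub: "\<And>t. subalgebra M (F t)"
    and increasing: "\<And>t. sets (F t) \<subseteq> sets (F (Suc t))"
begin

lemma measurable_Suc: "f \<in> borel_measurable (F t) \<Longrightarrow> f \<in> borel_measurable (F (Suc t))"
  using measurable_from_subalg[of "F (Suc t)" "F t" f borel] sub[of t] sub[of "Suc t"] increasing[of t]
  by (auto simp: subalgebra_def)

lemma measurable_le: "f \<in> borel_measurable (F i) \<Longrightarrow> i \<le> t \<Longrightarrow> f \<in> borel_measurable (F t)"
  by (rotate_tac 1, induction rule: dec_induct) (auto intro: measurable_Suc)

lemma measurable_M: "f \<in> borel_measurable (F t) \<Longrightarrow> f \<in> borel_measurable M"
  by (rule measurable_from_subalg[OF sub])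

lemma sets_M: "A \<in> sets (F t) \<Longrightarrow> A \<in> sets M"
  using sub[of t] by (auto simp: subalgebra_def)

lemma space_F: "space (F t) = space M"
  using sub[of t] by (auto simp: subalgebra_def)

lemma holding_adapted:
  assumes "\<And>t. U t \<in> borel_measurable (F t)"
  shows "{\<omega> \<in> space M. holding a b (\<lambda>i. U i \<omega>) t} \<in> sets (F t)"
proof (induction t)
  case 0
  note [measurable] = assms[of 0]
  have "{\<omega> \<in> space (F 0). U 0 \<omega> \<le> a} \<in> sets (F 0)" by measurable
  then show ?case by (simp add: space_F)
next
  case (Suc t)
  note [measurable] = assms[of "Suc t"]
  let ?H = "{\<omega> \<in> space M. holding a b (\<lambda>i. U i \<omega>) t}"
  have [measurable]: "?H \<in> sets (F (Suc t))"
    using Suc increasing by blast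
  have "{\<omega> \<in> space (F (Suc t)). if \<omega> \<in> ?H then U (Suc t) \<omega> < b else U (Suc t) \<omega> \<le> a} \<in> sets (F (Suc t))"
    by measurable
  also have "{\<omega> \<in> space (F (Suc t)). if \<omega> \<in> ?H then U (Suc t) \<omega> < b else U (Suc t) \<omega> \<le> a}
     = {\<omega> \<in> space M. holding a b (\<lambda>i. U i \<omega>) (Suc t)}"
    by (auto simp: space_F)
  finally show ?case .
qed

end

text \<open>
  The supermartingale inequality is stated by integrating over the events of the past; this is
  the defining property of the conditional expectation and keeps that operator out of the proofs.
\<close>

locale nonneg_supermartingale = discrete_filtration M F + prob_space M
  for M :: "'a measure" and F +
  fixes U :: "nat \<Rightarrow> 'a \<Rightarrow> real"
  assumes adapted: "\<And>t. U t \<in> borel_measurable (F t)"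
    and integrable: "\<And>t. integrable M (U t)"
    and nonneg: "\<And>t \<omega>. 0 \<le> U t \<omega>"
    and decreasing: "\<And>t A. A \<in> sets (F t) \<Longrightarrow>
      (\<integral>\<omega>. indicator A \<omega> * U (Suc t) \<omega> \<partial>M) \<le> (\<integral>\<omega>. indicator A \<omega> * U t \<omega> \<partial>M)"
begin

lemma measurable_U [measurable]: "U t \<in> borel_measurable M"
  by (rule measurable_M[OF adapted])

lemma pred_holding [measurable]: "Measurable.pred M (\<lambda>\<omega>. holding a b (\<lambda>i. U i \<omega>) t)"
  using sets_M[OF holding_adapted[of U a b t, OF adapted]] by (simp add: pred_def)

lemma pred_selling [measurable]: "Measurable.pred M (\<lambda>\<omega>. selling a b (\<lambda>i. U i \<omega>) t)"
  unfolding selling_def by measurable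

lemma integrable_sales: "integrable M (\<lambda>\<omega>. \<Sum>i<t. of_bool (selling a b (\<lambda>i. U i \<omega>) i) :: real)"
  by (intro Bochner_Integration.integrable_sum integrable_const_bound[where B = 1]) auto

text \<open>
  Holding the asset during a period decided by the past has nonpositive expected gain, so the
  expectation of \<open>upcrossing_wealth\<close> bounds the number of upcrossings uniformly in \<open>t\<close>.
\<close>

lemma expected_upcrossings:
  assumes "0 \<le> a" "a < b"
  shows "(b - a) * (\<integral>\<omega>. (\<Sum>i<t. of_bool (selling a b (\<lambda>i. U i \<omega>) i)) \<partial>M) \<le> a"
proof -
  define H where "H i = {\<omega> \<in> space M. holding a b (\<lambda>i. U i \<omega>) i}" for i
  define D where "D i \<omega> = indicator (H i) \<omega> * U (Suc i) \<omega> - indicator (H i) \<omega> * U i \<omega>" for i \<omega>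
  have H: "H i \<in> sets (F i)" for i
    unfolding H_def by (rule holding_adapted[OF adapted])
  have HM: "H i \<in> sets M" for i
    by (rule sets_M[OF H])
  have int: "integrable M (\<lambda>\<omega>. indicator (H i) \<omega> * U j \<omega>)" for i j
    using integrable_mult_indicator[OF HM integrable] by simp
  have intD: "integrable M (D i)" for i
    unfolding D_def by (intro Bochner_Integration.integrable_diff int)
  have D: "(\<integral>\<omega>. D i \<omega> \<partial>M) \<le> 0" for i
    unfolding D_def using decreasing[OF H[of i]] by (subst Bochner_Integration.integral_diff) (auto intro: int)
  have "(\<integral>\<omega>. (b - a) * (\<Sum>i<t. of_bool (selling a b (\<lambda>i. U i \<omega>) i)) \<partial>M) \<le> (\<integral>\<omega>. a + (\<Sum>i<t. D i \<omega>) \<partial>M)"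
  proof (rule integral_mono)
    show "integrable M (\<lambda>\<omega>. (b - a) * (\<Sum>i<t. of_bool (selling a b (\<lambda>i. U i \<omega>) i)))"
      by (intro integrable_mult_right integrable_sales)
    show "integrable M (\<lambda>\<omega>. a + (\<Sum>i<t. D i \<omega>))"
      by (intro Bochner_Integration.integrable_add Bochner_Integration.integrable_sum intD) auto
    fix \<omega> assume "\<omega> \<in> space M"
    then have "(\<Sum>i<t. D i \<omega>) = (\<Sum>i<t. of_bool (holding a b (\<lambda>i. U i \<omega>) i) * (U (Suc i) \<omega> - U i \<omega>))"
      by (intro sum.cong) (auto simp: D_def H_def)
    then show "(b - a) * (\<Sum>i<t. of_bool (selling a b (\<lambda>i. U i \<omega>) i)) \<le> a + (\<Sum>i<t. D i \<omega>)"
      using upcrossing_wealth[of b a "\<lambda>i. U i \<omega>" t] nonneg[of t \<omega>] \<open>0 \<le> a\<close> by (auto split: if_splits)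
  qed
  also have "\<dots> = a + (\<Sum>i<t. \<integral>\<omega>. D i \<omega> \<partial>M)"
    by (subst Bochner_Integration.integral_add) (auto simp: prob_space intD intro!: Bochner_Integration.integrable_sum)
  also have "\<dots> \<le> a"
    using D by (simp add: sum_nonpos)
  finally show ?thesis by simp
qed

lemma finitely_many_upcrossings:
  assumes "0 \<le> a" "a < b"
  shows "AE \<omega> in M. \<not> (\<exists>\<^sub>F t in sequentially. selling a b (\<lambda>i. U i \<omega>) t)"
proof -
  let ?s = "\<lambda>i \<omega>. of_bool (selling a b (\<lambda>i. U i \<omega>) i) :: real"
  have "(\<integral>\<^sup>+\<omega>. (\<Sum>i. ennreal (?s i \<omega>)) \<partial>M) = (\<Sum>i. \<integral>\<^sup>+\<omega>. ennreal (?s i \<omega>) \<partial>M)"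
    by (rule nn_integral_suminf) measurable
  also have "\<dots> \<le> ennreal (a / (b - a))"
  proof (rule suminf_le_const)
    fix t
    have "(\<Sum>i<t. \<integral>\<^sup>+\<omega>. ennreal (?s i \<omega>) \<partial>M) = (\<integral>\<^sup>+\<omega>. ennreal (\<Sum>i<t. ?s i \<omega>) \<partial>M)"
      by (subst nn_integral_sum[symmetric]) (auto simp: sum_ennreal)
    also have "\<dots> = ennreal (\<integral>\<omega>. (\<Sum>i<t. ?s i \<omega>) \<partial>M)"
      by (rule nn_integral_eq_integral[OF integrable_sales])
         (auto intro!: AE_I2 sum_nonneg)
    also have "\<dots> \<le> ennreal (a / (b - a))"
      using expected_upcrossings[OF assms, of t] \<open>a < b\<close> by (intro ennreal_leI) (simp add: field_simps)
    finally show "(\<Sum>i<t. \<integral>\<^sup>+\<omega>. ennreal (?s i \<omega>) \<partial>M) \<le> ennreal (a / (b - a))" .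
  qed auto
  also have "\<dots> < \<infinity>" by simp
  finally have "AE \<omega> in M. (\<Sum>i. ennreal (?s i \<omega>)) \<noteq> \<infinity>"
    by (intro nn_integral_PInf_AE) auto
  then show ?thesis
  proof (rule AE_mp, intro AE_I2 impI)
    fix \<omega> assume "(\<Sum>i. ennreal (?s i \<omega>)) \<noteq> \<infinity>"
    then have "summable (\<lambda>i. ?s i \<omega>)"
      by (intro summable_suminf_not_top) auto
    then have "(\<lambda>i. ?s i \<omega>) \<longlonglongrightarrow> 0" by (rule summable_LIMSEQ_zero)
    then have "\<forall>\<^sub>F i in sequentially. ?s i \<omega> < 1" by (rule order_tendstoD) simp
    then show "\<not> (\<exists>\<^sub>F t in sequentially. selling a b (\<lambda>i. U i \<omega>) t)"
      by (auto simp: not_frequently elim!: eventually_mono)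
  qed
qed

lemma expectation_le: "(\<integral>\<omega>. U t \<omega> \<partial>M) \<le> (\<integral>\<omega>. U 0 \<omega> \<partial>M)"
proof (induction t)
  case (Suc t)
  have "space M \<in> sets (F t)" using sets.top[of "F t"] by (simp add: space_F)
  then have "(\<integral>\<omega>. indicator (space M) \<omega> * U (Suc t) \<omega> \<partial>M) \<le> (\<integral>\<omega>. indicator (space M) \<omega> * U t \<omega> \<partial>M)"
    by (rule decreasing)
  moreover have "(\<integral>\<omega>. indicator (space M) \<omega> * U i \<omega> \<partial>M) = (\<integral>\<omega>. U i \<omega> \<partial>M)" for i
    by (rule Bochner_Integration.integral_cong) auto
  ultimately show ?case using Suc by simp
qed simp

text \<open>
  Doob's convergence theorem. Fatou's lemma and the decrease of the expectations make the lower
  limit finite almost surely, as \<open>convergent_if_finitely_many_upcrossings\<close> requires.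
\<close>

theorem converges_AE: "AE \<omega> in M. convergent (\<lambda>t. U t \<omega>)"
proof -
  have "(\<integral>\<^sup>+\<omega>. liminf (\<lambda>t. ennreal (U t \<omega>)) \<partial>M) \<le> liminf (\<lambda>t. \<integral>\<^sup>+\<omega>. ennreal (U t \<omega>) \<partial>M)"
    by (rule nn_integral_liminf) measurable
  also have "\<dots> \<le> liminf (\<lambda>t::nat. ennreal (\<integral>\<omega>. U 0 \<omega> \<partial>M))"
    by (intro Liminf_mono always_eventually allI)
       (simp add: nn_integral_eq_integral integrable nonneg ennreal_leI expectation_le)
  also have "\<dots> < \<infinity>" by (simp add: Liminf_const)
  finally have "AE \<omega> in M. liminf (\<lambda>t. ennreal (U t \<omega>)) \<noteq> \<infinity>"
    by (intro nn_integral_PInf_AE) auto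
  moreover have "AE \<omega> in M. \<forall>a\<in>\<rat>. \<forall>b\<in>\<rat>. 0 \<le> a \<longrightarrow> a < b \<longrightarrow> \<not> (\<exists>\<^sub>F t in sequentially. selling a b (\<lambda>i. U i \<omega>) t)"
    using finitely_many_upcrossings by (auto simp: AE_ball_countable countable_rat)
  ultimately show ?thesis
  proof eventually_elim
    case (elim \<omega>)
    then show ?case
      by (intro convergent_if_finitely_many_upcrossings nonneg) (auto simp: top.not_eq_extremum)
  qed
qed

end

section \<open>The Robbins-Siegmund theorem\<close>

context discrete_filtration begin

text \<open>
  Dividing by the product \<open>P\<close> of the growth factors \<open>1 + \<beta>\<close> removes the growth, and adding the
  decrements \<open>V\<close> already collected turns the descent inequality into the supermartingale property
  of \<open>U t = L t / P t + (\<Sum>i<t. V i / P (Suc i))\<close>. Since \<open>\<beta>\<close> is summable, \<open>P\<close> stays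
  between \<open>1\<close> and a finite limit, so convergence of \<open>U\<close> carries over to \<open>L\<close> and to the series
  of the \<open>V\<close>.
\<close>

theorem Robbins_Siegmund:
  fixes L V :: "nat \<Rightarrow> 'a \<Rightarrow> real" and \<beta> :: "nat \<Rightarrow> real"
  assumes "prob_space M"
    and \<beta>: "\<And>t. 0 \<le> \<beta> t" "summable \<beta>"
    and L: "\<And>t. L t \<in> borel_measurable (F t)" "\<And>t. integrable M (L t)" "\<And>t \<omega>. 0 \<le> L t \<omega>"
    and V: "\<And>t. V t \<in> borel_measurable (F t)" "\<And>t. integrable M (V t)" "\<And>t \<omega>. 0 \<le> V t \<omega>"
    and descent: "\<And>t A. A \<in> sets (F t) \<Longrightarrow>
      (\<integral>\<omega>. indicator A \<omega> * L (Suc t) \<omega> \<partial>M)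
        \<le> (1 + \<beta> t) * (\<integral>\<omega>. indicator A \<omega> * L t \<omega> \<partial>M) - (\<integral>\<omega>. indicator A \<omega> * V t \<omega> \<partial>M)"
  shows "AE \<omega> in M. convergent (\<lambda>t. L t \<omega>) \<and> summable (\<lambda>t. V t \<omega>)"
proof -
  interpret prob_space M by fact
  define P where "P t = (\<Prod>i<t. 1 + \<beta> i)" for t
  have P_Suc: "P (Suc t) = P t * (1 + \<beta> t)" for t by (simp add: P_def)
  have P_ge: "1 \<le> P t" for t unfolding P_def using \<beta>(1) by (intro prod_ge_1) auto
  then have P_pos: "0 < P t" for t using less_le_trans zero_less_one by blast
  have P_le: "P t \<le> exp (suminf \<beta>)" for t
  proof -
    have "P t \<le> exp (\<Sum>i<t. \<beta> i)"
      unfolding P_def exp_sum[OF finite_lessThan] using \<beta>(1) by (intro prod_mono) (auto simp: exp_ge_add_one_self add_nonneg_nonneg)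
    also have "\<dots> \<le> exp (suminf \<beta>)"
      using sum_le_suminf[OF \<beta>(2)] \<beta>(1) by simp
    finally show ?thesis .
  qed
  have "incseq P" using \<beta>(1) P_pos by (intro incseq_SucI) (simp add: P_Suc algebra_simps less_imp_le)
  then obtain p where p: "P \<longlonglongrightarrow> p"
    using incseq_convergent[of P "exp (suminf \<beta>)"] P_le by blast
  define U where "U t \<omega> = L t \<omega> / P t + (\<Sum>i<t. V i \<omega> / P (Suc i))" for t \<omega>
  have "nonneg_supermartingale M F U"
  proof
    show "U t \<in> borel_measurable (F t)" for t
    proof -
      have "V i \<in> borel_measurable (F t)" if "i < t" for i
        using measurable_le[OF V(1)] that by simp
      then show ?thesis unfolding U_def using L(1) by (intro borel_measurable_add borel_measurable_sum borel_measurable_divide) auto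
    qed
    show intU: "integrable M (U t)" for t
      unfolding U_def using L(2) V(2) by auto
    show "0 \<le> U t \<omega>" for t \<omega>
      unfolding U_def using L(3) V(3) P_pos by (intro add_nonneg_nonneg sum_nonneg divide_nonneg_pos) auto
    fix t A assume A: "A \<in> sets (F t)"
    then have AM: "A \<in> sets M" by (rule sets_M)
    have int: "integrable M (\<lambda>\<omega>. indicator A \<omega> * f \<omega>)" if "integrable M f" for f :: "'a \<Rightarrow> real"
      using integrable_mult_indicator[OF AM that] by simp
    let ?S = "\<lambda>\<omega>. \<Sum>i<t. V i \<omega> / P (Suc i)"
    have intS: "integrable M ?S" using V(2) by auto
    have "(\<integral>\<omega>. indicator A \<omega> * U (Suc t) \<omega> \<partial>M)
      = (\<integral>\<omega>. (1 / P (Suc t)) * (indicator A \<omega> * L (Suc t) \<omega>)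
          + ((1 / P (Suc t)) * (indicator A \<omega> * V t \<omega>) + indicator A \<omega> * ?S \<omega>) \<partial>M)"
      by (rule Bochner_Integration.integral_cong) (auto simp: U_def algebra_simps)
    also have "\<dots> = (1 / P (Suc t)) * (\<integral>\<omega>. indicator A \<omega> * L (Suc t) \<omega> \<partial>M)
          + ((1 / P (Suc t)) * (\<integral>\<omega>. indicator A \<omega> * V t \<omega> \<partial>M) + (\<integral>\<omega>. indicator A \<omega> * ?S \<omega> \<partial>M))"
      by (subst Bochner_Integration.integral_add, (intro Bochner_Integration.integrable_add integrable_mult_right int L(2) V(2) intS)+)+
         (simp only: integral_mult_right_zero)
    also have "\<dots> \<le> (1 / P (Suc t)) * ((1 + \<beta> t) * (\<integral>\<omega>. indicator A \<omega> * L t \<omega> \<partial>M)) + (\<integral>\<omega>. indicator A \<omega> * ?S \<omega> \<partial>M)"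
      using mult_left_mono[OF descent[OF A], of "1 / P (Suc t)"] P_pos[of "Suc t"]
      by (simp add: right_diff_distrib)
    also have "(1 / P (Suc t)) * ((1 + \<beta> t) * (\<integral>\<omega>. indicator A \<omega> * L t \<omega> \<partial>M)) = (1 / P t) * (\<integral>\<omega>. indicator A \<omega> * L t \<omega> \<partial>M)"
      using \<beta>(1)[of t] by (simp add: P_Suc)
    also have "\<dots> + (\<integral>\<omega>. indicator A \<omega> * ?S \<omega> \<partial>M) = (\<integral>\<omega>. (1 / P t) * (indicator A \<omega> * L t \<omega>) + indicator A \<omega> * ?S \<omega> \<partial>M)"
      by (subst Bochner_Integration.integral_add, (intro Bochner_Integration.integrable_add integrable_mult_right int L(2) V(2) intS)+)
         (simp only: integral_mult_right_zero)
    also have "\<dots> = (\<integral>\<omega>. indicator A \<omega> * U t \<omega> \<partial>M)"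
      by (rule Bochner_Integration.integral_cong) (auto simp: U_def algebra_simps)
    finally show "(\<integral>\<omega>. indicator A \<omega> * U (Suc t) \<omega> \<partial>M) \<le> (\<integral>\<omega>. indicator A \<omega> * U t \<omega> \<partial>M)" .
  qed
  then interpret U: nonneg_supermartingale M F U .
  show ?thesis
    using U.converges_AE
  proof eventually_elim
    case (elim \<omega>)
    then have "Bseq (\<lambda>t. U t \<omega>)" by (rule convergent_imp_Bseq)
    then obtain K where K: "\<And>t. \<bar>U t \<omega>\<bar> \<le> K" by (auto simp: Bseq_def)
    have summ: "summable (\<lambda>i. V i \<omega> / P (Suc i))"
    proof (rule bounded_imp_summable)
      show "0 \<le> V i \<omega> / P (Suc i)" for i using V(3) P_pos by (simp add: less_imp_le)
      show "(\<Sum>i\<le>t. V i \<omega> / P (Suc i)) \<le> K" for t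
      proof -
        have "(\<Sum>i\<le>t. V i \<omega> / P (Suc i)) \<le> U (Suc t) \<omega>"
          unfolding U_def lessThan_Suc_atMost using L(3) P_pos by (simp add: less_imp_le)
        then show ?thesis using K[of "Suc t"] by linarith
      qed
    qed
    have "summable (\<lambda>i. V i \<omega>)"
    proof (rule summable_comparison_test')
      show "summable (\<lambda>i. exp (suminf \<beta>) * (V i \<omega> / P (Suc i)))" by (intro summable_mult summ)
      show "norm (V i \<omega>) \<le> exp (suminf \<beta>) * (V i \<omega> / P (Suc i))" for i
        using mult_right_mono[OF P_le[of "Suc i"] V(3)[of i \<omega>]] P_pos[of "Suc i"] V(3)[of i \<omega>]
        by (simp add: field_simps)
    qed
    moreover have "convergent (\<lambda>t. L t \<omega>)"
    proof -
      obtain u where u: "(\<lambda>t. U t \<omega>) \<longlonglongrightarrow> u" using elim by (auto simp: convergent_def)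
      have "(\<lambda>t. P t * (U t \<omega> - (\<Sum>i<t. V i \<omega> / P (Suc i)))) \<longlonglongrightarrow> p * (u - (\<Sum>i. V i \<omega> / P (Suc i)))"
        by (intro tendsto_intros p u summable_LIMSEQ summ)
      moreover have "P t * (U t \<omega> - (\<Sum>i<t. V i \<omega> / P (Suc i))) = L t \<omega>" for t
        using P_pos[of t] by (simp add: U_def)
      ultimately show ?thesis by (auto simp: convergent_def)
    qed
    ultimately show ?case by simp
  qed
qed

end

section \<open>Descent driven by independent draws from a finite type\<close>

text \<open>
  Finitely many draws from a finite type have finitely many outcomes. Every set of outcomes is
  therefore an event, and every function of them is measurable and bounded.
\<close>

lemma sets_PiM_count_space_finite:
  assumes "finite I"
  shows "sets (PiM I (\<lambda>_. count_space (UNIV :: 'r::finite set))) = Pow (PiE I (\<lambda>_. UNIV))"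
proof (rule antisym)
  show "sets (PiM I (\<lambda>_. count_space (UNIV :: 'r set))) \<subseteq> Pow (PiE I (\<lambda>_. UNIV))"
    using sets.sets_into_space[of _ "PiM I (\<lambda>_. count_space (UNIV :: 'r set))"] by (auto simp: space_PiM)
  show "Pow (PiE I (\<lambda>_. UNIV)) \<subseteq> sets (PiM I (\<lambda>_. count_space (UNIV :: 'r set)))"
  proof
    fix S :: "('a \<Rightarrow> 'r) set"
    assume S: "S \<in> Pow (PiE I (\<lambda>_. UNIV))"
    have "finite (PiE I (\<lambda>_. UNIV :: 'r set))" using assms by (intro finite_PiE) auto
    then have fin: "finite S" using S finite_subset by blast
    have "{h} \<in> sets (PiM I (\<lambda>_. count_space (UNIV :: 'r set)))" if "h \<in> S" for h
    proof -
      have "h \<in> PiE I (\<lambda>_. UNIV)" using S that by blast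
      then have "{h} = PiE I (\<lambda>i. {h i})" by (metis PiE_singleton PiE_def IntE)
      also have "\<dots> \<in> sets (PiM I (\<lambda>_. count_space UNIV))" using assms by (intro sets_PiM_I_finite) auto
      finally show ?thesis .
    qed
    then have "(\<Union>h\<in>S. {h}) \<in> sets (PiM I (\<lambda>_. count_space (UNIV :: 'r set)))"
      using fin by (intro sets.finite_UN)
    then show "S \<in> sets (PiM I (\<lambda>_. count_space (UNIV :: 'r set)))" by simp
  qed
qed

definition history :: "(nat \<Rightarrow> 'a \<Rightarrow> 'r) \<Rightarrow> nat \<Rightarrow> 'a \<Rightarrow> nat \<Rightarrow> 'r" where
  "history r t \<omega> = restrict (\<lambda>i. r i \<omega>) {..<t}"

definition past :: "'a measure \<Rightarrow> (nat \<Rightarrow> 'a \<Rightarrow> 'r) \<Rightarrow> nat \<Rightarrow> 'a measure" where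
  "past M r t = vimage_algebra (space M) (history r t) (count_space UNIV)"

text \<open>
  The iteration as a deterministic function of the sequence of draws, which displays the random
  iterate at time \<open>t\<close> as a function of the first \<open>t\<close> draws.
\<close>

primrec iterate :: "(nat \<Rightarrow> 'r \<Rightarrow> 'c \<Rightarrow> 'c) \<Rightarrow> 'c \<Rightarrow> nat \<Rightarrow> (nat \<Rightarrow> 'r) \<Rightarrow> 'c" where
  "iterate upd x 0 h = x"
| "iterate upd x (Suc t) h = upd t (h t) (iterate upd x t h)"

lemma iterate_cong: "(\<And>i. i < t \<Longrightarrow> h i = h' i) \<Longrightarrow> iterate upd x t h = iterate upd x t h'"
  by (induction t) auto

lemma iterate_history_Suc:
  "iterate upd x (Suc t) (history r (Suc t) \<omega>) = upd t (r t \<omega>) (iterate upd x t (history r t \<omega>))"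
  using iterate_cong[of t "history r (Suc t) \<omega>" "history r t \<omega>" upd x] by (simp add: history_def)

locale independent_draws = prob_space M for M :: "'a measure" +
  fixes r :: "nat \<Rightarrow> 'a \<Rightarrow> 'r::finite"
  assumes indep: "indep_vars (\<lambda>_. count_space UNIV) r UNIV"
begin

lemma measurable_r [measurable]: "r t \<in> measurable M (count_space UNIV)"
  using indep by (auto simp: indep_vars_def)

lemma history_in_PiE: "history r t \<omega> \<in> PiE {..<t} (\<lambda>_. UNIV)"
  by (auto simp: history_def)

lemma measurable_history: "history r t \<in> measurable M (count_space UNIV)"
proof (rule measurableI)
  fix S :: "(nat \<Rightarrow> 'r) set"
  have "history r t \<in> measurable M (PiM {..<t} (\<lambda>_. count_space UNIV))"
    unfolding history_def[abs_def] by (rule measurable_restrict) measurable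
  then have "history r t -` (S \<inter> PiE {..<t} (\<lambda>_. UNIV)) \<inter> space M \<in> sets M"
    by (rule measurable_sets) (simp add: sets_PiM_count_space_finite)
  also have "history r t -` (S \<inter> PiE {..<t} (\<lambda>_. UNIV)) \<inter> space M = history r t -` S \<inter> space M"
    using history_in_PiE by blast
  finally show "history r t -` S \<inter> space M \<in> sets M" .
qed auto

lemma sets_past: "sets (past M r t) = {history r t -` S \<inter> space M | S. True}"
  unfolding past_def by (subst sets_vimage_algebra2) auto

lemma space_past: "space (past M r t) = space M"
  by (simp add: past_def)

lemma measurable_past: "(\<lambda>\<omega>. f (history r t \<omega>)) \<in> borel_measurable (past M r t)"
proof -
  have "history r t \<in> measurable (past M r t) (count_space UNIV)"
    unfolding past_def by (rule measurable_vimage_algebra1) simp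
  then show ?thesis by (rule measurable_compose) simp
qed

sublocale discrete_filtration M "past M r"
proof
  fix t
  show "subalgebra M (past M r t)"
    using measurable_sets[OF measurable_history] by (auto simp: subalgebra_def sets_past space_past)
  have "history r t -` S = history r (Suc t) -` {h. restrict h {..<t} \<in> S}" for S
  proof -
    have "history r t \<omega> = restrict (history r (Suc t) \<omega>) {..<t}" for \<omega>
      by (auto simp: history_def restrict_def)
    then show ?thesis by auto
  qed
  then show "sets (past M r t) \<subseteq> sets (past M r (Suc t))"
    unfolding sets_past by blast
qed

lemma integrable_history: "integrable M (\<lambda>\<omega>. f (history r t \<omega>) :: real)"
proof (rule integrable_const_bound)
  have "finite (PiE {..<t} (\<lambda>_. UNIV :: 'r set))" by (intro finite_PiE) auto
  then have "\<bar>f (history r t \<omega>)\<bar> \<le> (\<Sum>h\<in>PiE {..<t} (\<lambda>_. UNIV). \<bar>f h\<bar>)" for \<omega>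
    by (intro member_le_sum[where f = "\<lambda>h. \<bar>f h\<bar>"] history_in_PiE) auto
  then show "AE \<omega> in M. norm (f (history r t \<omega>)) \<le> (\<Sum>h\<in>PiE {..<t} (\<lambda>_. UNIV). \<bar>f h\<bar>)" by simp
  show "(\<lambda>\<omega>. f (history r t \<omega>)) \<in> borel_measurable M"
    by (rule measurable_M[OF measurable_past])
qed

text \<open>
  The conditional expectation given the past, in integrated form: the next draw is independent of
  the history and can be averaged out while the history is kept fixed.
\<close>

lemma expectation_next_draw:
  fixes g :: "(nat \<Rightarrow> 'r) \<Rightarrow> 'r \<Rightarrow> real"
  shows "(\<integral>\<omega>. g (history r t \<omega>) (r t \<omega>) \<partial>M)
    = (\<Sum>q\<in>UNIV. prob {\<omega> \<in> space M. r t \<omega> = q} * (\<integral>\<omega>. g (history r t \<omega>) q \<partial>M))"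
proof -
  have ind: "integrable M (\<lambda>\<omega>. indicator {q} (r t \<omega>) :: real)" for q
    by (rule integrable_const_bound[where B = 1]) (auto simp: indicator_def)
  have indep': "indep_var borel (\<lambda>\<omega>. g (history r t \<omega>) q) borel (\<lambda>\<omega>. indicator {q} (r t \<omega>) :: real)" for q
  proof -
    have "indep_var borel ((\<lambda>h. g h q) \<circ> (\<lambda>\<omega>. restrict (\<lambda>i. r i \<omega>) {..<t}))
        borel ((\<lambda>h. indicator {q} (h t) :: real) \<circ> (\<lambda>\<omega>. restrict (\<lambda>i. r i \<omega>) {t}))"
    proof (rule indep_var_compose[OF indep_var_restrict[OF indep]])
      show "(\<lambda>h. g h q) \<in> borel_measurable (PiM {..<t} (\<lambda>_. count_space UNIV))"
        by (rule measurableI) (auto simp: sets_PiM_count_space_finite space_PiM)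
      show "(\<lambda>h. indicator {q} (h t) :: real) \<in> borel_measurable (PiM {t} (\<lambda>_. count_space UNIV))"
        by (rule measurableI) (auto simp: sets_PiM_count_space_finite space_PiM)
    qed auto
    then show ?thesis by (simp add: o_def history_def)
  qed
  have prob_draw: "(\<integral>\<omega>. indicator {q} (r t \<omega>) \<partial>M) = prob {\<omega> \<in> space M. r t \<omega> = q}" for q
  proof -
    have "(\<integral>\<omega>. indicator {q} (r t \<omega>) \<partial>M) = (\<integral>\<omega>. indicator {\<omega> \<in> space M. r t \<omega> = q} \<omega> \<partial>M)"
      by (intro Bochner_Integration.integral_cong refl) (simp add: indicator_def)
    also have "\<dots> = prob {\<omega> \<in> space M. r t \<omega> = q}"
      by (subst Bochner_Integration.integral_indicator) (auto simp: Int_def intro!: arg_cong[where f = prob])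
    finally show ?thesis .
  qed
  have "(\<integral>\<omega>. g (history r t \<omega>) (r t \<omega>) \<partial>M) = (\<integral>\<omega>. (\<Sum>q\<in>UNIV. g (history r t \<omega>) q * indicator {q} (r t \<omega>)) \<partial>M)"
    by (intro Bochner_Integration.integral_cong refl) (simp add: indicator_def)
  also have "\<dots> = (\<Sum>q\<in>UNIV. \<integral>\<omega>. g (history r t \<omega>) q * indicator {q} (r t \<omega>) \<partial>M)"
    by (intro Bochner_Integration.integral_sum indep_var_integrable[OF indep' integrable_history ind])
  also have "\<dots> = (\<Sum>q\<in>UNIV. (\<integral>\<omega>. g (history r t \<omega>) q \<partial>M) * (\<integral>\<omega>. indicator {q} (r t \<omega>) \<partial>M))"
    by (intro sum.cong refl indep_var_lebesgue_integral[OF indep' integrable_history ind])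
  also have "\<dots> = (\<Sum>q\<in>UNIV. prob {\<omega> \<in> space M. r t \<omega> = q} * (\<integral>\<omega>. g (history r t \<omega>) q \<partial>M))"
    unfolding prob_draw by (simp only: mult.commute)
  finally show ?thesis .
qed

text \<open>
  A recursion driven by independent draws that decreases a loss on average, up to the summable
  growth \<open>\<beta>\<close>, satisfies the hypotheses of \<open>Robbins_Siegmund\<close> with respect to the past
  of the draws.
\<close>

theorem random_descent_converges:
  fixes z :: "nat \<Rightarrow> 'a \<Rightarrow> 'c" and l :: "'c \<Rightarrow> real" and v :: "nat \<Rightarrow> 'c \<Rightarrow> real"
  assumes z: "\<And>\<omega>. \<omega> \<in> space M \<Longrightarrow> z 0 \<omega> = x"
      "\<And>t \<omega>. \<omega> \<in> space M \<Longrightarrow> z (Suc t) \<omega> = upd t (r t \<omega>) (z t \<omega>)"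
    and \<beta>: "\<And>t. 0 \<le> \<beta> t" "summable \<beta>"
    and nonneg: "\<And>x. 0 \<le> l x" "\<And>t x. 0 \<le> v t x"
    and descent: "\<And>t x. (\<Sum>q\<in>UNIV. prob {\<omega> \<in> space M. r t \<omega> = q} * l (upd t q x)) \<le> (1 + \<beta> t) * l x - v t x"
  shows "AE \<omega> in M. convergent (\<lambda>t. l (z t \<omega>)) \<and> summable (\<lambda>t. v t (z t \<omega>))"
proof -
  define Z where "Z t \<omega> = iterate upd x t (history r t \<omega>)" for t \<omega>
  have z_eq: "z t \<omega> = Z t \<omega>" if "\<omega> \<in> space M" for t \<omega>
  proof (induction t)
    case (Suc t)
    then show ?case using z(2)[OF that] by (simp only: Z_def iterate_history_Suc)
  qed (simp add: Z_def z(1)[OF that])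
  have "AE \<omega> in M. convergent (\<lambda>t. l (Z t \<omega>)) \<and> summable (\<lambda>t. v t (Z t \<omega>))"
  proof (rule Robbins_Siegmund[OF prob_space_axioms \<beta>])
    fix t
    show "(\<lambda>\<omega>. l (Z t \<omega>)) \<in> borel_measurable (past M r t)" "(\<lambda>\<omega>. v t (Z t \<omega>)) \<in> borel_measurable (past M r t)"
      unfolding Z_def by (rule measurable_past)+
    show "integrable M (\<lambda>\<omega>. l (Z t \<omega>))" "integrable M (\<lambda>\<omega>. v t (Z t \<omega>))"
      unfolding Z_def by (rule integrable_history)+
    show "0 \<le> l (Z t \<omega>)" "0 \<le> v t (Z t \<omega>)" for \<omega> by (rule nonneg)+
    \<comment> \<open>An event of the past is a set of histories, so its indicator can be part of the function \<open>g\<close>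
      to which \<open>expectation_next_draw\<close> is applied.\<close>
    fix A assume "A \<in> sets (past M r t)"
    then obtain S where A: "A = history r t -` S \<inter> space M" by (auto simp: sets_past)
    let ?I = "indicator S :: _ \<Rightarrow> real"
    let ?l = "\<lambda>h. l (iterate upd x t h)" and ?v = "\<lambda>h. v t (iterate upd x t h)"
    have A_int: "(\<integral>\<omega>. indicator A \<omega> * f \<omega> \<partial>M) = (\<integral>\<omega>. ?I (history r t \<omega>) * f \<omega> \<partial>M)" for f :: "'a \<Rightarrow> real"
      by (intro Bochner_Integration.integral_cong refl) (simp add: A indicator_def)
    have "(\<integral>\<omega>. indicator A \<omega> * l (Z (Suc t) \<omega>) \<partial>M)
      = (\<integral>\<omega>. ?I (history r t \<omega>) * l (upd t (r t \<omega>) (iterate upd x t (history r t \<omega>))) \<partial>M)"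
      unfolding A_int Z_def iterate_history_Suc ..
    also have "\<dots> = (\<Sum>q\<in>UNIV. prob {\<omega> \<in> space M. r t \<omega> = q} *
        (\<integral>\<omega>. ?I (history r t \<omega>) * l (upd t q (iterate upd x t (history r t \<omega>))) \<partial>M))"
      by (rule expectation_next_draw[where g = "\<lambda>h q. ?I h * l (upd t q (iterate upd x t h))"])
    also have "\<dots> = (\<integral>\<omega>. (\<Sum>q\<in>UNIV. prob {\<omega> \<in> space M. r t \<omega> = q} *
        (?I (history r t \<omega>) * l (upd t q (iterate upd x t (history r t \<omega>))))) \<partial>M)"
      by (subst Bochner_Integration.integral_sum) (auto intro: integrable_mult_right integrable_history[where f = "\<lambda>h. ?I h * l (upd t _ (iterate upd x t h))"])
    also have "\<dots> \<le> (\<integral>\<omega>. (1 + \<beta> t) * (?I (history r t \<omega>) * ?l (history r t \<omega>))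
        - ?I (history r t \<omega>) * ?v (history r t \<omega>) \<partial>M)"
    proof (rule integral_mono)
      fix \<omega>
      let ?x = "iterate upd x t (history r t \<omega>)"
      have "?I (history r t \<omega>) * (\<Sum>q\<in>UNIV. prob {\<omega> \<in> space M. r t \<omega> = q} * l (upd t q ?x))
        \<le> ?I (history r t \<omega>) * ((1 + \<beta> t) * l ?x - v t ?x)"
        by (intro mult_left_mono descent) auto
      then show "(\<Sum>q\<in>UNIV. prob {\<omega> \<in> space M. r t \<omega> = q} * (?I (history r t \<omega>) * l (upd t q ?x)))
        \<le> (1 + \<beta> t) * (?I (history r t \<omega>) * ?l (history r t \<omega>)) - ?I (history r t \<omega>) * ?v (history r t \<omega>)"
        by (simp add: sum_distrib_left algebra_simps)
    qed (rule integrable_history[where f = "\<lambda>h. \<Sum>q\<in>UNIV. prob {\<omega> \<in> space M. r t \<omega> = q} * (?I h * l (upd t q (iterate upd x t h)))"]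
            integrable_history[where f = "\<lambda>h. (1 + \<beta> t) * (?I h * ?l h) - ?I h * ?v h"])+
    also have "\<dots> = (1 + \<beta> t) * (\<integral>\<omega>. indicator A \<omega> * l (Z t \<omega>) \<partial>M) - (\<integral>\<omega>. indicator A \<omega> * v t (Z t \<omega>) \<partial>M)"
      unfolding A_int Z_def
      by (subst Bochner_Integration.integral_diff)
         (simp_all only: integral_mult_right_zero
           integrable_history[where f = "\<lambda>h. (1 + \<beta> t) * (?I h * ?l h)"] integrable_history[where f = "\<lambda>h. ?I h * ?v h"])
    finally show "(\<integral>\<omega>. indicator A \<omega> * l (Z (Suc t) \<omega>) \<partial>M) \<le>
      (1 + \<beta> t) * (\<integral>\<omega>. indicator A \<omega> * l (Z t \<omega>) \<partial>M) - (\<integral>\<omega>. indicator A \<omega> * v t (Z t \<omega>) \<partial>M)" .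
  qed
  then show ?thesis
    using AE_space by eventually_elim (simp add: z_eq)
qed

end

section \<open>The amplitude loss and its Wirtinger gradient\<close>

text \<open>
  The loss of the full stack and that of a single block differ only in the measurement matrix
  and the measured amplitudes. The loss, the residual and the Wirtinger gradient are therefore treated for an
  arbitrary matrix and amplitude vector.
\<close>

definition amp_loss :: "complex ^ 'n ^ 'm \<Rightarrow> real ^ 'm \<Rightarrow> complex ^ 'n \<Rightarrow> real" where
  "amp_loss B b z = (norm (abs_vec (B *v z) - b))\<^sup>2"

definition residual :: "complex ^ 'n ^ 'm \<Rightarrow> real ^ 'm \<Rightarrow> complex ^ 'n \<Rightarrow> complex ^ 'm" where
  "residual B b z = B *v z - complex_vec b * sgn_vec (B *v z)"

definition amp_grad :: "complex ^ 'n ^ 'm \<Rightarrow> real ^ 'm \<Rightarrow> complex ^ 'n \<Rightarrow> complex ^ 'n" where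
  "amp_grad B b z = conj_transpose B *v residual B b z"

lemma power2_norm_vec: "(norm (v :: 'a::real_normed_vector ^ 'n))\<^sup>2 = (\<Sum>i\<in>UNIV. (norm (v $ i))\<^sup>2)"
  by (simp add: norm_vec_def L2_set_def sum_nonneg)

lemma amp_loss_eq_sum: "amp_loss B b z = (\<Sum>k\<in>UNIV. (cmod ((B *v z) $ k) - b $ k)\<^sup>2)"
  by (simp add: amp_loss_def power2_norm_vec abs_vec_def)

lemma residual_nth: "residual B b z $ k = (B *v z) $ k - b $ k *\<^sub>R sgn ((B *v z) $ k)"
  by (simp add: residual_def complex_vec_def sgn_vec_def scaleR_conv_of_real)

text \<open>
  The inner product on \<open>complex ^ 'n\<close> is the real one, that is the real part of the Hermitian
  product.
\<close>

lemma adjoint_conj_transpose: "(conj_transpose B *v u) \<bullet> h = u \<bullet> (B *v h)"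
proof -
  have in_cnj: "x \<bullet> y = Re (cnj x * y)" for x y :: complex
    by (simp add: inner_complex_def)
  have "(conj_transpose B *v u) \<bullet> h = (\<Sum>i\<in>UNIV. \<Sum>j\<in>UNIV. Re (B $ j $ i * cnj (u $ j) * h $ i))"
    unfolding inner_vec_def in_cnj by (simp add: matrix_vector_mult_def conj_transpose_def cnj_sum sum_distrib_right Re_sum)
  also have "\<dots> = (\<Sum>j\<in>UNIV. \<Sum>i\<in>UNIV. Re (B $ j $ i * cnj (u $ j) * h $ i))"
    by (rule sum.swap)
  also have "\<dots> = u \<bullet> (B *v h)"
    unfolding inner_vec_def in_cnj by (simp add: matrix_vector_mult_def sum_distrib_left Re_sum mult_ac)
  finally show ?thesis .
qed

text \<open>
  The square \<open>(norm u - b)\<^sup>2\<close> is a quadratic function of \<open>u\<close> minus \<open>2 b\<close> times the norm.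
  The norm is convex with subgradient \<open>sgn u\<close>, where the value \<open>0\<close> at the origin is admissible,
  so for \<open>b \<ge> 0\<close> the nonsmooth term lies below its linearisation. This is why the
  nonsmooth loss obeys the descent inequality of a smooth one, everywhere.
\<close>

lemma amplitude_descent_scalar:
  fixes u v :: complex
  assumes "0 \<le> b"
  shows "(norm (u + v) - b)\<^sup>2 \<le> (norm u - b)\<^sup>2 + 2 * ((u - b *\<^sub>R sgn u) \<bullet> v) + (norm v)\<^sup>2"
proof -
  have "norm u + sgn u \<bullet> v \<le> norm (u + v)"
  proof (cases "u = 0")
    case False
    have "sgn u \<bullet> u = norm u"
      using False by (simp add: sgn_div_norm dot_square_norm power2_eq_square)
    then have "norm u + sgn u \<bullet> v = sgn u \<bullet> (u + v)" by (simp add: inner_add_right)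
    also have "\<dots> \<le> norm (sgn u) * norm (u + v)" by (rule norm_cauchy_schwarz)
    finally show ?thesis using False by (simp add: norm_sgn)
  qed simp
  then have "b * (norm u + sgn u \<bullet> v) \<le> b * norm (u + v)"
    using assms by (rule mult_left_mono)
  moreover have "(norm (u + v))\<^sup>2 = (norm u)\<^sup>2 + 2 * (u \<bullet> v) + (norm v)\<^sup>2"
    by (simp add: power2_norm_eq_inner inner_add_left inner_add_right inner_commute)
  ultimately show ?thesis
    by (simp add: power2_diff inner_diff_left algebra_simps)
qed

lemma amp_loss_descent:
  assumes "\<And>k. 0 \<le> b $ k"
  shows "amp_loss B b (z + h) \<le> amp_loss B b z + 2 * (amp_grad B b z \<bullet> h) + (norm (B *v h))\<^sup>2"
proof -
  have "amp_loss B b (z + h) = (\<Sum>k\<in>UNIV. (cmod ((B *v z) $ k + (B *v h) $ k) - b $ k)\<^sup>2)"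
    by (simp add: amp_loss_eq_sum matrix_vector_right_distrib)
  also have "\<dots> \<le> (\<Sum>k\<in>UNIV. (cmod ((B *v z) $ k) - b $ k)\<^sup>2 + 2 * (residual B b z $ k \<bullet> (B *v h) $ k)
      + (norm ((B *v h) $ k))\<^sup>2)"
    unfolding residual_nth by (intro sum_mono amplitude_descent_scalar assms)
  also have "\<dots> = amp_loss B b z + 2 * (residual B b z \<bullet> (B *v h)) + (norm (B *v h))\<^sup>2"
    by (simp add: sum.distrib amp_loss_eq_sum power2_norm_vec inner_vec_def sum_distrib_left)
  finally show ?thesis by (simp add: amp_grad_def adjoint_conj_transpose)
qed

text \<open>
  For a nonzero entry \<open>u\<close> of the product, \<open>u\<close> and \<open>b *\<^sub>R sgn u\<close> are collinear and the
  two contributions agree; for a vanishing entry the residual is \<open>0\<close>, as \<open>sgn 0 = 0\<close>.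
\<close>

lemma norm_residual_le: "(norm (residual B b z))\<^sup>2 \<le> amp_loss B b z"
proof -
  have "(norm (u - c *\<^sub>R sgn u))\<^sup>2 \<le> (norm u - c)\<^sup>2" for u :: complex and c
  proof (cases "u = 0")
    case False
    have "u - c *\<^sub>R sgn u = (norm u - c) *\<^sub>R sgn u"
      using False by (simp add: sgn_div_norm algebra_simps)
    then show ?thesis using False by (simp add: norm_sgn)
  qed simp
  then show ?thesis
    unfolding amp_loss_eq_sum power2_norm_vec residual_nth by (intro sum_mono)
qed

lemma norm_amp_grad_bound:
  obtains K where "0 \<le> K" "\<And>b z. (norm (amp_grad B b z))\<^sup>2 \<le> K * amp_loss B b z"
proof -
  obtain C where C: "\<And>u. norm (conj_transpose B *v u) \<le> norm u * C" "0 \<le> C"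
    using bounded_linear.nonneg_bounded[OF matrix_vector_mul_bounded_linear, of "conj_transpose B"] by blast
  have "(norm (amp_grad B b z))\<^sup>2 \<le> C\<^sup>2 * amp_loss B b z" for b z
  proof -
    have "(norm (amp_grad B b z))\<^sup>2 \<le> (norm (residual B b z) * C)\<^sup>2"
      unfolding amp_grad_def by (intro power_mono C) auto
    also have "\<dots> \<le> C\<^sup>2 * amp_loss B b z"
      using mult_left_mono[OF norm_residual_le, of "C\<^sup>2" B b z] by (simp add: power_mult_distrib mult_ac)
    finally show ?thesis .
  qed
  then show thesis using that[of "C\<^sup>2"] by simp
qed

lemma diag_mult_vec: "diag v *v u = v * (u :: complex ^ 'n)"
proof -
  have "(\<Sum>j\<in>UNIV. (if i = j then v $ i else 0) * u $ j) = v $ i * u $ i" for i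
    by (subst sum.mono_neutral_right[of UNIV "{i}"]) auto
  then show ?thesis by (simp add: vec_eq_iff diag_def matrix_vector_mult_def)
qed

section \<open>The ptychographic update as a block gradient step\<close>

lemma sum_roots_of_unity:
  fixes m :: int
  assumes "\<bar>m\<bar> < int d"
  shows "(\<Sum>k<d. exp (2 * of_real pi * \<i> * of_nat k * of_int m / of_nat d)) = (if m = 0 then of_nat d else (0::complex))"
proof (cases "m = 0")
  case False
  have d: "0 < d" using assms by (cases d) auto
  define \<zeta> where "\<zeta> = exp (2 * of_real pi * \<i> * of_int m / of_nat d :: complex)"
  have pow: "exp (2 * of_real pi * \<i> * of_nat k * of_int m / of_nat d) = \<zeta> ^ k" for k
    unfolding \<zeta>_def exp_of_nat_mult[symmetric] by (simp add: mult_ac)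
  have "\<zeta> ^ d = exp (2 * of_int m * of_real pi * \<i>)"
    unfolding \<zeta>_def exp_of_nat_mult[symmetric] using d by (simp add: mult_ac)
  also have "\<dots> = 1" unfolding exp_eq_1 by (auto intro!: exI[of _ m])
  finally have "\<zeta> ^ d = 1" .
  moreover have "\<zeta> \<noteq> 1"
  proof
    assume "\<zeta> = 1"
    then obtain n :: int where "2 * pi * of_int m / of_nat d = of_int (2 * n) * pi"
      unfolding \<zeta>_def exp_eq_1 by (auto simp: Im_divide_of_nat)
    then have "real_of_int m = of_int (n * int d)" using d by (simp add: field_simps)
    then have "m = n * int d" by linarith
    then have "n \<noteq> 0" "\<bar>m\<bar> = \<bar>n\<bar> * int d" using False by (auto simp: abs_mult)
    then have "1 * int d \<le> \<bar>m\<bar>" by (simp only:) (intro mult_right_mono; linarith)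
    then show False using assms by simp
  qed
  ultimately show ?thesis using False by (simp add: pow geometric_sum)
qed simp

lemma sum_mod_ring_int: "(\<Sum>k\<in>(UNIV :: 'd::finite mod_ring set). f (to_int_mod_ring k)) = (\<Sum>k<CARD('d). f (int k))"
proof (rule sum.reindex_bij_witness[of _ "\<lambda>k. of_int_mod_ring (int k)" "\<lambda>k. nat (to_int_mod_ring k)"])
  have "to_int_mod_ring a \<in> {0..<int CARD('d)}" for a :: "'d mod_ring"
    using range_to_int_mod_ring by blast
  then show "of_int_mod_ring (int (nat (to_int_mod_ring a))) = a" "nat (to_int_mod_ring a) \<in> {..<CARD('d)}"
    "f (int (nat (to_int_mod_ring a))) = f (to_int_mod_ring a)" for a :: "'d mod_ring"
    by (auto simp: nat_less_iff)
qed auto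

text \<open>
  The columns of the Fourier matrix are orthogonal with squared norm \<open>CARD('d)\<close>. In the
  update rule this lets the inverse be exchanged for the adjoint that occurs in the gradient.
\<close>

lemma dft_unitary: "conj_transpose dft ** dft = (diag (\<chi> _. of_nat CARD('d)) :: complex ^ ('d::finite mod_ring) ^ 'd mod_ring)"
proof -
  have "(conj_transpose dft ** dft) $ j $ l = (if j = l then of_nat CARD('d) else 0)" for j l :: "'d mod_ring"
  proof -
    let ?m = "to_int_mod_ring j - to_int_mod_ring l"
    have "to_int_mod_ring a \<in> {0..<int CARD('d)}" for a :: "'d mod_ring"
      using range_to_int_mod_ring by blast
    from this[of j] this[of l] have m: "\<bar>?m\<bar> < int CARD('d)" by auto
    have "(conj_transpose dft ** dft) $ j $ l
      = (\<Sum>k\<in>UNIV. cnj (dft $ k $ j) * dft $ k $ (l :: 'd mod_ring))"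
      by (simp add: matrix_matrix_mult_def conj_transpose_def)
    also have "\<dots> = (\<Sum>k\<in>(UNIV :: 'd mod_ring set). exp (2 * of_real pi * \<i> * of_int (to_int_mod_ring k) * of_int ?m / of_nat CARD('d)))"
      by (intro sum.cong refl) (simp add: dft_def exp_cnj exp_add[symmetric] algebra_simps diff_divide_distrib add_divide_distrib)
    also have "\<dots> = (\<Sum>k<CARD('d). exp (2 * of_real pi * \<i> * of_nat k * of_int ?m / of_nat CARD('d)))"
      by (subst sum_mod_ring_int[where f = "\<lambda>k. exp (2 * of_real pi * \<i> * of_int k * of_int ?m / of_nat CARD('d))"]) simp
    also have "\<dots> = (if ?m = 0 then of_nat CARD('d) else 0)"
      by (rule sum_roots_of_unity[OF m])
    also have "?m = 0 \<longleftrightarrow> j = l" by simp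
    finally show ?thesis .
  qed
  then show ?thesis by (simp add: vec_eq_iff diag_def)
qed

lemma conj_transpose_dft_mult:
  "conj_transpose dft *v (dft *v v) = real CARD('d) *\<^sub>R (v :: complex ^ ('d::finite mod_ring))"
  by (simp add: matrix_vector_mul_assoc dft_unitary diag_mult_vec vec_eq_iff of_nat_index scaleR_conv_of_real)

lemma conj_transpose_dft_eq_inv:
  fixes u :: "complex ^ ('d::finite mod_ring)"
  shows "conj_transpose dft *v u = real CARD('d) *\<^sub>R (matrix_inv dft *v u)"
proof -
  have "inj ((*v) (dft :: complex ^ ('d mod_ring) ^ 'd mod_ring))"
  proof (rule injI)
    fix u v :: "complex ^ ('d mod_ring)"
    assume "dft *v u = dft *v v"
    then have "real CARD('d) *\<^sub>R u = real CARD('d) *\<^sub>R v"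
      by (metis conj_transpose_dft_mult)
    then show "u = v" by simp
  qed
  then have "invertible (dft :: complex ^ ('d mod_ring) ^ 'd mod_ring)"
    using invertible_left_inverse matrix_left_invertible_injective by blast
  then have "dft ** matrix_inv dft = (mat 1 :: complex ^ ('d mod_ring) ^ 'd mod_ring)"
    unfolding invertible_def matrix_inv_def by (rule someI2_ex) simp
  then have "dft *v (matrix_inv dft *v u) = u" by (simp add: matrix_vector_mul_assoc)
  then show ?thesis by (metis conj_transpose_dft_mult)
qed

lemma conj_transpose_mult: "conj_transpose (A ** B) = conj_transpose B ** conj_transpose A"
  by (simp add: conj_transpose_def matrix_matrix_mult_def vec_eq_iff cnj_sum mult.commute)

lemma conj_transpose_diag: "conj_transpose (diag v) = diag (conj_vec v)"
  by (auto simp: conj_transpose_def diag_def conj_vec_def vec_eq_iff)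

text \<open>
  The scaled inverse transform is the adjoint of the transform and the conjugated window is the adjoint of
  the windowing, so the engine performs a gradient step for the loss of the block that was drawn.
\<close>

lemma pie_step_eq_gradient_step:
  fixes z :: "complex ^ ('d::finite mod_ring)"
  shows "pie_step w a \<sigma> y z =
    z - (a / (max_norm w)\<^sup>2 / real CARD('d)) *\<^sub>R amp_grad (block_matrix w \<sigma>) (sqrt_vec y) z"
proof -
  let ?S = "circ_shift \<sigma> w"
  have fwd: "block_matrix w \<sigma> *v z = dft *v (?S * z)"
    by (simp add: block_matrix_def matrix_vector_mul_assoc[symmetric] diag_mult_vec)
  have "amp_grad (block_matrix w \<sigma>) (sqrt_vec y) z = diag (conj_vec ?S) *v (conj_transpose dft *v
      (dft *v (?S * z) - complex_vec (sqrt_vec y) * sgn_vec (dft *v (?S * z))))"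
    unfolding amp_grad_def residual_def fwd
    by (simp add: block_matrix_def conj_transpose_mult conj_transpose_diag matrix_vector_mul_assoc)
  also have "conj_transpose dft *v (dft *v (?S * z) - complex_vec (sqrt_vec y) * sgn_vec (dft *v (?S * z)))
      = - (real CARD('d) *\<^sub>R (matrix_inv dft *v (complex_vec (sqrt_vec y) * sgn_vec (dft *v (?S * z))) - ?S * z))"
    by (simp add: matrix_vector_mult_diff_distrib conj_transpose_dft_mult) (simp add: conj_transpose_dft_eq_inv scaleR_diff_right)
  also have "diag (conj_vec ?S) *v - (real CARD('d) *\<^sub>R u) = - (real CARD('d) *\<^sub>R (diag (conj_vec ?S) *v u))" for u
    by (simp add: diag_mult_vec vec_eq_iff)
  finally show ?thesis by (simp add: pie_step_def)
qed

lemma loss_eq_sum_blocks: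
  "loss w s y z = (\<Sum>q\<in>UNIV. amp_loss (block_matrix w (s q)) (sqrt_vec (y q)) z)"
proof -
  have "loss w s y z = (\<Sum>(q, k)\<in>UNIV. (cmod ((block_matrix w (s q) *v z) $ k) - sqrt_vec (y q) $ k)\<^sup>2)"
    unfolding loss_def amp_loss_def[symmetric] amp_loss_eq_sum
    by (intro sum.cong refl) (simp add: stack_matrix_def stack_vec_def sqrt_vec_def matrix_vector_mult_def split: prod.split)
  then show ?thesis
    by (simp add: amp_loss_eq_sum sum.cartesian_product)
qed

lemma wirtinger_grad_eq_amp_grad:
  "wirtinger_grad w s y = amp_grad (stack_matrix w s) (sqrt_vec (stack_vec y))"
  by (simp add: fun_eq_iff wirtinger_grad_def amp_grad_def residual_def)

lemma loss_eq_amp_loss: "loss w s y = amp_loss (stack_matrix w s) (sqrt_vec (stack_vec y))"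
  by (simp add: fun_eq_iff loss_def amp_loss_def)

lemma wirtinger_grad_eq_sum_blocks:
  "wirtinger_grad w s y z = (\<Sum>q\<in>UNIV. amp_grad (block_matrix w (s q)) (sqrt_vec (y q)) z)"
proof -
  have stack: "stack_matrix w s $ p = block_matrix w (s (fst p)) $ snd p" for p
    by (simp add: stack_matrix_def)
  have res: "residual (stack_matrix w s) (sqrt_vec (stack_vec y)) z $ p
      = residual (block_matrix w (s (fst p))) (sqrt_vec (y (fst p))) z $ snd p" for p
    by (simp add: residual_nth stack_matrix_def stack_vec_def sqrt_vec_def matrix_vector_mult_def)
  have "wirtinger_grad w s y z $ i = (\<Sum>q\<in>UNIV. amp_grad (block_matrix w (s q)) (sqrt_vec (y q)) z $ i)" for i
  proof -
    have "wirtinger_grad w s y z $ i = (\<Sum>(q, k)\<in>UNIV. cnj (block_matrix w (s q) $ k $ i) * residual (block_matrix w (s q)) (sqrt_vec (y q)) z $ k)"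
      unfolding wirtinger_grad_eq_amp_grad
      by (simp add: amp_grad_def conj_transpose_def matrix_vector_mult_def res stack case_prod_beta)
    then show ?thesis
      by (simp add: amp_grad_def conj_transpose_def matrix_vector_mult_def sum.cartesian_product)
  qed
  then show ?thesis by (simp add: vec_eq_iff sum_component)
qed

lemma max_norm_pos: "0 < max_norm w" if "w \<noteq> 0"
proof -
  obtain i where "w $ i \<noteq> 0" using \<open>w \<noteq> 0\<close> by (auto simp: vec_eq_iff)
  then have "0 < cmod (w $ i)" by simp
  also have "\<dots> \<le> max_norm w" unfolding max_norm_def by (intro Max_ge) auto
  finally show ?thesis .
qed

text \<open>
  The step follows the gradient of one block, while the full loss is measured. The first-order
  term then pairs the full gradient with the block gradient, and only after averaging over the
  blocks does it become the squared norm of the full gradient. The second-order term is at most a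
  multiple of the block loss, hence of the full loss; it can be absorbed into a growth factor
  without any bound on the iterates.
\<close>

lemma block_step_descent:
  fixes y :: "'r::finite \<Rightarrow> real ^ ('d::finite mod_ring)"
  assumes y: "\<And>q k. 0 \<le> y q $ k"
  obtains C where "0 \<le> C"
    "\<And>q z \<gamma>. loss w s y (z - \<gamma> *\<^sub>R amp_grad (block_matrix w (s q)) (sqrt_vec (y q)) z)
      \<le> (1 + C * \<gamma>\<^sup>2) * loss w s y z
        - 2 * \<gamma> * (wirtinger_grad w s y z \<bullet> amp_grad (block_matrix w (s q)) (sqrt_vec (y q)) z)"
proof -
  define G where "G q z = amp_grad (block_matrix w (s q)) (sqrt_vec (y q)) z" for q z
  obtain B where B: "\<And>u. norm (stack_matrix w s *v u) \<le> norm u * B" "0 \<le> B"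
    using bounded_linear.nonneg_bounded[OF matrix_vector_mul_bounded_linear, of "stack_matrix w s"] by blast
  have "\<exists>K\<ge>0. \<forall>b z. (norm (amp_grad (block_matrix w (s q)) b z))\<^sup>2 \<le> K * amp_loss (block_matrix w (s q)) b z" for q
    using norm_amp_grad_bound[of "block_matrix w (s q)"] by metis
  then obtain K where K: "\<And>q. 0 \<le> K q"
    "\<And>q b z. (norm (amp_grad (block_matrix w (s q)) b z))\<^sup>2 \<le> K q * amp_loss (block_matrix w (s q)) b z"
    by metis
  have nonneg: "0 \<le> amp_loss A b z" for A :: "complex ^ ('d mod_ring) ^ 'd mod_ring" and b z by (simp add: amp_loss_def)
  have G: "(norm (G q z))\<^sup>2 \<le> (\<Sum>q\<in>UNIV. K q) * loss w s y z" for q z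
  proof -
    have "(norm (G q z))\<^sup>2 \<le> K q * amp_loss (block_matrix w (s q)) (sqrt_vec (y q)) z"
      unfolding G_def by (rule K(2))
    also have "\<dots> \<le> (\<Sum>q\<in>UNIV. K q) * loss w s y z"
      unfolding loss_eq_sum_blocks
      by (intro mult_mono member_le_sum sum_nonneg K nonneg) auto
    finally show ?thesis .
  qed
  show thesis
  proof (rule that)
    show "0 \<le> B\<^sup>2 * (\<Sum>q\<in>UNIV. K q)" by (simp add: K(1) sum_nonneg)
    fix q z \<gamma>
    have "0 \<le> sqrt_vec (stack_vec y) $ k" for k by (simp add: sqrt_vec_def stack_vec_def y)
    then have "loss w s y (z + (- \<gamma>) *\<^sub>R G q z) \<le> loss w s y z + 2 * (wirtinger_grad w s y z \<bullet> ((- \<gamma>) *\<^sub>R G q z))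
      + (norm (stack_matrix w s *v ((- \<gamma>) *\<^sub>R G q z)))\<^sup>2"
      unfolding loss_eq_amp_loss wirtinger_grad_eq_amp_grad by (rule amp_loss_descent)
    also have "(norm (stack_matrix w s *v ((- \<gamma>) *\<^sub>R G q z)))\<^sup>2 \<le> (norm ((- \<gamma>) *\<^sub>R G q z) * B)\<^sup>2"
      by (intro power_mono B) auto
    also have "\<dots> = \<gamma>\<^sup>2 * B\<^sup>2 * (norm (G q z))\<^sup>2" by (simp add: power_mult_distrib)
    also have "\<dots> \<le> \<gamma>\<^sup>2 * B\<^sup>2 * ((\<Sum>q\<in>UNIV. K q) * loss w s y z)" by (intro mult_left_mono G) auto
    finally show "loss w s y (z - \<gamma> *\<^sub>R amp_grad (block_matrix w (s q)) (sqrt_vec (y q)) z)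
      \<le> (1 + B\<^sup>2 * (\<Sum>q\<in>UNIV. K q) * \<gamma>\<^sup>2) * loss w s y z
        - 2 * \<gamma> * (wirtinger_grad w s y z \<bullet> amp_grad (block_matrix w (s q)) (sqrt_vec (y q)) z)"
      unfolding G_def by (simp add: algebra_simps)
  qed
qed

section \<open>The rate of the running minimum\<close>

text \<open>
  On the block from \<open>T / 2\<close> to \<open>T\<close> the running minimum, weighted by at least \<open>T powr -p\<close>, is
  added about \<open>T / 2\<close> times. The block sum is thus at least half of the minimum times
  \<open>T powr (1 - p)\<close>, and it is bounded by a tail of the convergent series. Using the tail
  rather than the full partial sum gives little-o in place of big-O.
\<close>

lemma Min_smallo_if_weighted_summable:
  fixes g :: "nat \<Rightarrow> real"
  assumes g: "\<And>t. 0 \<le> g t" and p: "0 < p" "p' = 1 - p"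
    and summ: "summable (\<lambda>t. g t / (1 + real t) powr p)"
  shows "(\<lambda>T. MIN t\<in>{0..<T}. g t) \<in> o(\<lambda>T. real T powr - p')"
proof -
  define f where "f t = g t / (1 + real t) powr p" for t
  have f: "0 \<le> f t" for t using g by (simp add: f_def)
  have summ: "summable f" using summ by (simp add: f_def[abs_def])
  define tail where "tail m = (\<Sum>k. f (k + m))" for m
  have tail: "tail \<longlonglongrightarrow> 0"
    unfolding tail_def[abs_def] using suminf_exist_split2[OF summ] by simp
  have m_lim: "filterlim (\<lambda>T::nat. T div 2) at_top at_top"
    unfolding filterlim_at_top
  proof
    fix Z :: nat
    show "\<forall>\<^sub>F T in sequentially. Z \<le> T div 2"
      using eventually_ge_at_top[of "2 * Z"] by eventually_elim linarith
  qed
  have bound: "(MIN t\<in>{0..<T}. g t) * real T powr p' \<le> 2 * tail (T div 2)"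
    and nonneg: "0 \<le> (MIN t\<in>{0..<T}. g t)" if T: "0 < T" for T
  proof -
    let ?m = "MIN t\<in>{0..<T}. g t"
    show m0: "0 \<le> ?m" using g T by (subst Min_ge_iff) auto
    have "?m * real T powr p' = real T * (?m / real T powr p)"
      using T by (simp add: p(2) powr_diff)
    also have "\<dots> \<le> 2 * real (card {T div 2..<T}) * (?m / real T powr p)"
      using m0 by (intro mult_right_mono) auto
    also have "\<dots> = 2 * (real (card {T div 2..<T}) * (?m / real T powr p))"
      by (simp only: mult.assoc)
    also have "real (card {T div 2..<T}) * (?m / real T powr p) = (\<Sum>t\<in>{T div 2..<T}. ?m / real T powr p)"
      by simp
    also have "\<dots> \<le> (\<Sum>t\<in>{T div 2..<T}. f t)"
    proof (rule sum_mono)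
      fix t assume t: "t \<in> {T div 2..<T}"
      have "?m \<le> g t" using t by (intro Min_le) auto
      moreover have "(1 + real t) powr p \<le> real T powr p" using t p(1) by (intro powr_mono2) auto
      ultimately show "?m / real T powr p \<le> f t"
        unfolding f_def using m0 by (intro frac_le) auto
    qed
    also have "(\<Sum>t\<in>{T div 2..<T}. f t) = (\<Sum>k<T - T div 2. f (k + T div 2))"
      by (rule sum.reindex_bij_witness[of _ "\<lambda>k. k + T div 2" "\<lambda>t. t - T div 2"]) auto
    also have "\<dots> \<le> tail (T div 2)"
      unfolding tail_def using summ f by (intro sum_le_suminf) (auto simp: summable_iff_shift)
    finally show "?m * real T powr p' \<le> 2 * tail (T div 2)" by simp
  qed
  have "(\<lambda>T. 2 * tail (T div 2)) \<longlonglongrightarrow> 2 * 0"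
    by (intro tendsto_intros filterlim_compose[OF tail m_lim])
  then have lim: "(\<lambda>T. 2 * tail (T div 2)) \<longlonglongrightarrow> 0" by simp
  have pos: "\<forall>\<^sub>F T::nat in sequentially. 0 < T" by (rule eventually_gt_at_top)
  have "(\<lambda>T. (MIN t\<in>{0..<T}. g t) * real T powr p') \<longlonglongrightarrow> 0"
  proof (rule tendsto_sandwich[OF _ _ tendsto_const lim])
    show "\<forall>\<^sub>F T in sequentially. 0 \<le> (MIN t\<in>{0..<T}. g t) * real T powr p'"
      using pos by eventually_elim (intro mult_nonneg_nonneg nonneg powr_ge_zero)
    show "\<forall>\<^sub>F T in sequentially. (MIN t\<in>{0..<T}. g t) * real T powr p' \<le> 2 * tail (T div 2)"
      using pos by eventually_elim (rule bound)
  qed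
  moreover have "(MIN t\<in>{0..<T}. g t) / real T powr - p' = (MIN t\<in>{0..<T}. g t) * real T powr p'" for T
    by (simp add: powr_minus divide_inverse)
  ultimately have "(\<lambda>T. (MIN t\<in>{0..<T}. g t) / real T powr - p') \<longlonglongrightarrow> 0" by simp
  moreover have "\<forall>\<^sub>F T in sequentially. real T powr - p' \<noteq> 0"
    using pos by eventually_elim simp
  ultimately show ?thesis by (rule smalloI_tendsto)
qed

section \<open>Convergence of the Ptychographic Iterative Engine\<close>

theorem corollary3p13:
  fixes w x z0 :: "complex ^ ('d::finite mod_ring)"
    and s :: "'r::finite \<Rightarrow> nat"
    and y n :: "'r \<Rightarrow> real ^ ('d mod_ring)"
    and \<alpha> \<theta> :: real
    and step :: "nat \<Rightarrow> real"
    and M :: "'\<omega> measure"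
    and r :: "nat \<Rightarrow> '\<omega> \<Rightarrow> 'r"
    and z :: "nat \<Rightarrow> '\<omega> \<Rightarrow> complex ^ ('d mod_ring)"
  assumes w: "w \<noteq> 0"
    and shifts: "range s \<subseteq> {1..CARD('d)}" "inj s"
    and measurements:
      "\<And>q k. y q $ k = (abs_vec (dft *v (circ_shift (s q) w * x)) $ k)\<^sup>2 + n q $ k"
    and measurements_nonneg: "\<And>q k. 0 \<le> y q $ k"
    and prob: "prob_space M"
    and indep: "prob_space.indep_vars M (\<lambda>_. count_space UNIV) r UNIV"
    and uniform: "\<And>t q. measure M {\<omega> \<in> space M. r t \<omega> = q} = 1 / real CARD('r)"
    and params: "0 < \<alpha>" "0 < \<theta>" "\<theta> < 1 / 2"
    and step: "\<And>t. step t = \<alpha> / (1 + real t) powr (1 / 2 + \<theta>)"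
    and z_0: "\<And>\<omega>. \<omega> \<in> space M \<Longrightarrow> z 0 \<omega> = z0"
    and z_Suc: "\<And>t \<omega>. \<omega> \<in> space M \<Longrightarrow>
      z (Suc t) \<omega> = pie_step w (step t) (s (r t \<omega>)) (y (r t \<omega>)) (z t \<omega>)"
  shows "(AE \<omega> in M. convergent (\<lambda>t. loss w s y (z t \<omega>))) \<and>
    (AE \<omega> in M.
      (\<lambda>T. MIN t\<in>{0..<T}. (norm (wirtinger_grad w s y (z t \<omega>)))\<^sup>2)
        \<in> o(\<lambda>T. real T powr (- (1 / 2 - \<theta>))))"
proof -
  interpret prob_space M by (rule prob)
  interpret independent_draws M r by unfold_locales (rule indep)
  let ?R = "real CARD('r)"
  let ?G = "\<lambda>q z. amp_grad (block_matrix w (s q)) (sqrt_vec (y q)) z"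
  define c where "c = \<alpha> / (max_norm w)\<^sup>2 / real CARD('d)"
  define \<gamma> where "\<gamma> t = c / (1 + real t) powr (1 / 2 + \<theta>)" for t
  have c: "0 < c" unfolding c_def using params max_norm_pos[OF w] by simp
  have \<gamma>: "0 < \<gamma> t" for t using c by (simp add: \<gamma>_def)
  obtain C where C: "0 \<le> C"
    "\<And>q z \<gamma>. loss w s y (z - \<gamma> *\<^sub>R ?G q z)
      \<le> (1 + C * \<gamma>\<^sup>2) * loss w s y z - 2 * \<gamma> * (wirtinger_grad w s y z \<bullet> ?G q z)"
    using block_step_descent[of y w s] measurements_nonneg by metis
  have update: "z (Suc t) \<omega> = z t \<omega> - \<gamma> t *\<^sub>R ?G (r t \<omega>) (z t \<omega>)" if "\<omega> \<in> space M" for t \<omega>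
    using z_Suc[OF that, of t] by (simp add: pie_step_eq_gradient_step step \<gamma>_def c_def mult_ac)
  have descent: "(\<Sum>q\<in>UNIV. prob {\<omega> \<in> space M. r t \<omega> = q} * loss w s y (u - \<gamma> t *\<^sub>R ?G q u))
      \<le> (1 + C * (\<gamma> t)\<^sup>2) * loss w s y u - 2 * \<gamma> t / ?R * (norm (wirtinger_grad w s y u))\<^sup>2" for t u
  proof -
    have "(\<Sum>q\<in>UNIV. prob {\<omega> \<in> space M. r t \<omega> = q} * loss w s y (u - \<gamma> t *\<^sub>R ?G q u))
      \<le> (\<Sum>q\<in>UNIV. 1 / ?R * ((1 + C * (\<gamma> t)\<^sup>2) * loss w s y u - 2 * \<gamma> t * (wirtinger_grad w s y u \<bullet> ?G q u)))"
      unfolding uniform by (intro sum_mono mult_left_mono C(2)) auto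
    also have "\<dots> = (1 + C * (\<gamma> t)\<^sup>2) * loss w s y u
        - 2 * \<gamma> t / ?R * (wirtinger_grad w s y u \<bullet> (\<Sum>q\<in>UNIV. ?G q u))"
      by (simp add: right_diff_distrib sum_subtractf inner_sum_right sum_distrib_left)
    also have "(\<Sum>q\<in>UNIV. ?G q u) = wirtinger_grad w s y u"
      by (rule wirtinger_grad_eq_sum_blocks[symmetric])
    finally show ?thesis by (simp add: power2_norm_eq_inner)
  qed
  \<comment> \<open>Here \<open>\<theta> > 0\<close> enters: the squared step sizes decay faster than \<open>1 / t\<close>.\<close>
  have summable: "summable (\<lambda>t. C * (\<gamma> t)\<^sup>2)"
  proof -
    have "summable (\<lambda>t. real (Suc t) powr - (1 + 2 * \<theta>))"
      using params by (subst summable_Suc_iff) (simp add: summable_real_powr_iff)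
    moreover have "C * (\<gamma> t)\<^sup>2 = C * c\<^sup>2 * real (Suc t) powr - (1 + 2 * \<theta>)" for t
    proof -
      have "((1 + real t) powr (1 / 2 + \<theta>))\<^sup>2 = (1 + real t) powr (1 + 2 * \<theta>)"
        by (simp add: power2_eq_square flip: powr_add)
      then have "(\<gamma> t)\<^sup>2 = c\<^sup>2 / real (Suc t) powr (1 + 2 * \<theta>)"
        by (simp add: \<gamma>_def power_divide add.commute)
      then show ?thesis by (simp only: powr_minus_divide) simp
    qed
    ultimately show ?thesis by (simp only: summable_mult)
  qed
  have "AE \<omega> in M. convergent (\<lambda>t. loss w s y (z t \<omega>)) \<and>
      summable (\<lambda>t. 2 * \<gamma> t / ?R * (norm (wirtinger_grad w s y (z t \<omega>)))\<^sup>2)"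
    using \<gamma> C(1) by (intro random_descent_converges[OF z_0 update _ summable _ _ descent])
      (auto simp: loss_def less_imp_le)
  then have "AE \<omega> in M. convergent (\<lambda>t. loss w s y (z t \<omega>)) \<and>
      (\<lambda>T. MIN t\<in>{0..<T}. (norm (wirtinger_grad w s y (z t \<omega>)))\<^sup>2) \<in> o(\<lambda>T. real T powr (- (1 / 2 - \<theta>)))"
  proof eventually_elim
    case (elim \<omega>)
    let ?g = "\<lambda>t. (norm (wirtinger_grad w s y (z t \<omega>)))\<^sup>2"
    \<comment> \<open>The factor cancels the constants of the step size and leaves the pure power as weight.\<close>
    have "summable (\<lambda>t. (?R / (2 * c)) * (2 * \<gamma> t / ?R * ?g t))"
      using elim by (intro summable_mult) auto
    then have "summable (\<lambda>t. ?g t / (1 + real t) powr (1 / 2 + \<theta>))"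
      using c by (simp add: \<gamma>_def)
    then show ?case
      using elim params by (intro conjI Min_smallo_if_weighted_summable[where p = "1 / 2 + \<theta>"]) auto
  qed
  then show ?thesis by simp
qed

end
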